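(* Let $\mathfrak{g}=\mathfrak{g}_{4.3}$ be the four-dimensional real Lie algebra with basis $\mathcal{B}=\{e_1,e_2,e_3,e_4\}$ whose nonzero Lie brackets (up to skew-symmetry) are $[e_1,e_4]=e_1$, $[e_3,e_4]=e_2$. Let $\langle\cdot,\cdot\rangle$ be a pseudo-Riemannian inner product on $\mathfrak{g}$ and let $(R_{ij})$ be the matrix of its Ricci operator $\operatorname{Ric}$ in the basis $\mathcal{B}$. Then $\langle\cdot,\cdot\rangle$ is an algebraic Ricci soliton if and only if $$R_{i1}=0\ (i=2,3,4),\quad R_{32}=R_{42}=R_{43}=0,\quad R_{13}=R_{12}=0,\quad R_{33}=R_{22}.$$ Given these conditions, $\operatorname{Ric}=\eta I_4+D$ where $\eta=R_{44}$ and $$D=\begin{bmatrix}R_{11}-R_{44}&0&0&R_{14}\\0&R_{22}-R_{44}&R_{23}&R_{24}\\0&0&R_{22}-R_{44}&R_{34}\\0&0&0&0\end{bmatrix}$$ is (the matrix in the basis $\mathcal{B}$ of) a derivation of $\mathfrak{g}$.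
   Context: A pseudo-Riemannian inner product on a real Lie algebra $\mathfrak{g}$ is a nondegenerate symmetric bilinear form $\langle\cdot,\cdot\rangle$ on $\mathfrak{g}$ (of some signature $(r,s)$). Its Levi-Civita connection $\nabla$ is defined by $2\langle\nabla_uv,w\rangle=\langle[u,v],w\rangle+\langle[w,u],v\rangle+\langle[w,v],u\rangle$; its curvature is $R_{uv}=\nabla_{[u,v]}-[\nabla_u,\nabla_v]$; its Ricci curvature $\operatorname{ric}(u,v)$ is the trace of $w\mapsto R_{uw}v$; its Ricci operator $\operatorname{Ric}$ is the endomorphism of $\mathfrak{g}$ with $\langle\operatorname{Ric}(u),v\rangle=\operatorname{ric}(u,v)$. The matrix $(R_{ij})$ of $\operatorname{Ric}$ in a basis $\{e_i\}$ is given by $\operatorname{Ric}(e_j)=\sum_iR_{ij}e_i$ (the same column convention is used for $D$). A derivation is a linear map $D:\mathfrak{g}\to\mathfrak{g}$ with $D[x,y]=[D(x),y]+[x,D(y)]$ for all $x,y$. The inner product is an algebraic Ricci soliton if $\operatorname{Ric}=\eta\,\mathrm{Id}_{\mathfrak{g}}+D$ for some $\eta\in\mathbb{R}$ and some derivation $D$ of $\mathfrak{g}$. *)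

theory Defs
  imports "HOL-Analysis.Analysis"
begin

text \<open>
  A Lie algebra of dimension \<open>CARD('n)\<close> with a chosen basis is modelled as \<open>real ^ 'n\<close> with a bracket;
  the chosen basis is \<open>axis i 1\<close>. Matrices of endomorphisms are given by \<^const>\<open>matrix\<close>, which uses
  the column convention: \<open>f (axis j 1) = (\<Sum>i\<in>UNIV. matrix f $ i $ j *\<^sub>R axis i 1)\<close>.
\<close>

definition lie_bracket :: "('a::real_vector \<Rightarrow> 'a \<Rightarrow> 'a) \<Rightarrow> bool" where
  "lie_bracket br \<longleftrightarrow> bilinear br \<and> (\<forall>x. br x x = 0) \<and>
     (\<forall>x y z. br x (br y z) + br y (br z x) + br z (br x y) = 0)"

definition derivation :: "('a::real_vector \<Rightarrow> 'a \<Rightarrow> 'a) \<Rightarrow> ('a \<Rightarrow> 'a) \<Rightarrow> bool" where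
  "derivation br D \<longleftrightarrow> linear D \<and> (\<forall>x y. D (br x y) = br (D x) y + br x (D y))"

definition pseudo_riemannian :: "('a::real_vector \<Rightarrow> 'a \<Rightarrow> real) \<Rightarrow> bool" where
  "pseudo_riemannian g \<longleftrightarrow> bilinear g \<and> (\<forall>x y. g x y = g y x) \<and>
     (\<forall>x. (\<forall>y. g x y = 0) \<longrightarrow> x = 0)"

definition levi_civita ::
    "('a::real_vector \<Rightarrow> 'a \<Rightarrow> 'a) \<Rightarrow> ('a \<Rightarrow> 'a \<Rightarrow> real) \<Rightarrow> 'a \<Rightarrow> 'a \<Rightarrow> 'a" where
  "levi_civita br g u v =
     (THE x. \<forall>w. 2 * g x w = g (br u v) w + g (br w u) v + g (br w v) u)"

text \<open>Sign convention: \<open>R\<^sub>u\<^sub>v = \<nabla>\<^bsub>[u,v]\<^esub> - [\<nabla>\<^sub>u, \<nabla>\<^sub>v]\<close>.\<close>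

definition curvature ::
    "('a::real_vector \<Rightarrow> 'a \<Rightarrow> 'a) \<Rightarrow> ('a \<Rightarrow> 'a \<Rightarrow> real) \<Rightarrow> 'a \<Rightarrow> 'a \<Rightarrow> 'a \<Rightarrow> 'a" where
  "curvature br g u v w =
     levi_civita br g (br u v) w -
       (levi_civita br g u (levi_civita br g v w) - levi_civita br g v (levi_civita br g u w))"

definition ricci ::
    "(real^'n \<Rightarrow> real^'n \<Rightarrow> real^'n) \<Rightarrow> (real^'n \<Rightarrow> real^'n \<Rightarrow> real) \<Rightarrow> real^'n \<Rightarrow> real^'n \<Rightarrow> real" where
  "ricci br g u v = trace (matrix (\<lambda>w. curvature br g u w v))"

definition ricci_operator ::
    "(real^'n \<Rightarrow> real^'n \<Rightarrow> real^'n) \<Rightarrow> (real^'n \<Rightarrow> real^'n \<Rightarrow> real) \<Rightarrow> real^'n \<Rightarrow> real^'n" where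
  "ricci_operator br g u = (THE x. \<forall>v. g x v = ricci br g u v)"

definition algebraic_ricci_soliton ::
    "(real^'n \<Rightarrow> real^'n \<Rightarrow> real^'n) \<Rightarrow> (real^'n \<Rightarrow> real^'n \<Rightarrow> real) \<Rightarrow> bool" where
  "algebraic_ricci_soliton br g \<longleftrightarrow>
     (\<exists>\<eta> D. derivation br D \<and> (\<forall>u. ricci_operator br g u = \<eta> *\<^sub>R u + D u))"

definition g43 :: "real^4 \<Rightarrow> real^4 \<Rightarrow> real^4" where
  "g43 x y = (x$1 * y$4 - x$4 * y$1) *\<^sub>R axis 1 1 + (x$3 * y$4 - x$4 * y$3) *\<^sub>R axis 2 1"

lemma vector_4 [simp]:
  "(vector [a,b,c,d] :: 'a::zero^4) $ 1 = a" "(vector [a,b,c,d] :: 'a^4) $ 2 = b"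
  "(vector [a,b,c,d] :: 'a^4) $ 3 = c" "(vector [a,b,c,d] :: 'a^4) $ 4 = d"
  by (simp_all add: vector_def)

lemma g43_nth [simp]:
  "g43 x y $ 1 = x$1 * y$4 - x$4 * y$1" "g43 x y $ 2 = x$3 * y$4 - x$4 * y$3"
  "g43 x y $ 3 = 0" "g43 x y $ 4 = 0"
  by (simp_all add: g43_def axis_def)

lemma lie_bracket_g43: "lie_bracket g43"
proof -
  have "bilinear g43"
    unfolding bilinear_def
    by (intro conjI allI linearI; simp add: vec_eq_iff forall_4 algebra_simps)
  moreover have "g43 x (g43 y z) + g43 y (g43 z x) + g43 z (g43 x y) = 0" for x y z
    by (simp add: vec_eq_iff forall_4 algebra_simps)
  ultimately show ?thesis
    by (simp add: lie_bracket_def vec_eq_iff forall_4)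
qed

lemma g43_basis:
  "g43 (axis 1 1) (axis 4 1) = axis 1 1" "g43 (axis 3 1) (axis 4 1) = axis 2 1"
  "g43 (axis 1 1) (axis 2 1) = 0" "g43 (axis 1 1) (axis 3 1) = 0"
  "g43 (axis 2 1) (axis 3 1) = 0" "g43 (axis 2 1) (axis 4 1) = 0"
  by (simp_all add: vec_eq_iff forall_4) (simp_all add: axis_def)

text \<open>Nondegeneracy makes the definite descriptions above well defined.\<close>

lemma pseudo_riemannian_eqI:
  assumes "pseudo_riemannian g" "\<And>w. g x w = g y w"
  shows "x = y"
proof -
  have "bilinear g"
    using assms(1) by (simp add: pseudo_riemannian_def)
  then have "g (x - y) w = 0" for w
    by (simp add: bilinear_lsub assms(2))
  then have "x - y = 0"
    using assms(1) unfolding pseudo_riemannian_def by blast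
  then show ?thesis
    by simp
qed

lemma pseudo_riemannian_riesz:
  fixes g :: "real^'n \<Rightarrow> real^'n \<Rightarrow> real"
  assumes g: "pseudo_riemannian g" and "linear \<phi>"
  shows "\<exists>!x. \<forall>w. g x w = \<phi> w"
proof (rule ex_ex1I)
  have bl: "bilinear g"
    using g by (simp add: pseudo_riemannian_def)
  have lin2: "linear (g x)" for x
    using bl by (simp add: bilinear_def)
  define F where "F x = (\<chi> i. g x (axis i 1))" for x
  have ext: "g x w = \<phi>' w" if "linear \<phi>'" "\<And>i. g x (axis i 1) = \<phi>' (axis i 1)" for x w \<phi>'
    by (rule linear_eq_stdbasis[OF lin2 that(1), THEN fun_cong]) (use that(2) in \<open>auto simp: Basis_vec_def\<close>)
  have linF: "linear F"
    using bl by (auto intro!: linearI simp: F_def vec_eq_iff bilinear_ladd bilinear_lmul)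
  have "x = 0" if "F x = 0" for x
  proof -
    have "g x w = 0" for w
      by (rule ext) (use that in \<open>auto simp: F_def vec_eq_iff intro!: linearI\<close>)
    then show ?thesis using g by (auto simp: pseudo_riemannian_def)
  qed
  then have "inj F"
    using linF linear_injective_0 by blast
  then have "surj F"
    using linF linear_injective_imp_surjective by blast
  then obtain x where x: "F x = (\<chi> i. \<phi> (axis i 1))"
    by (metis surjD)
  have "g x w = \<phi> w" for w
    by (rule ext[OF assms(2)]) (use x in \<open>simp add: F_def vec_eq_iff\<close>)
  then have "\<forall>w. g x w = \<phi> w" ..
  then show "\<exists>x. \<forall>w. g x w = \<phi> w" ..
next
  show "x = y" if "\<forall>w. g x w = \<phi> w" "\<forall>w. g y w = \<phi> w" for x y
    using that by (auto intro!: pseudo_riemannian_eqI[OF g])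
qed

lemma levi_civita_koszul:
  fixes g :: "real^'n \<Rightarrow> real^'n \<Rightarrow> real"
  assumes g: "pseudo_riemannian g" and br: "bilinear br"
  shows "2 * g (levi_civita br g u v) w = g (br u v) w + g (br w u) v + g (br w v) u"
proof -
  have bl: "bilinear g"
    using g by (simp add: pseudo_riemannian_def)
  have "linear (\<lambda>w. (g (br u v) w + g (br w u) v + g (br w v) u) / 2)"
    using bl br
    by (auto intro!: linearI simp: bilinear_ladd bilinear_lmul bilinear_radd bilinear_rmul field_simps)
  from pseudo_riemannian_riesz[OF g this]
  have "\<exists>!x. \<forall>w. 2 * g x w = g (br u v) w + g (br w u) v + g (br w v) u"
    by (simp add: field_simps)
  from theI'[OF this] show ?thesis
    by (simp add: levi_civita_def)
qed

lemma bilinear_levi_civita: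
  fixes g :: "real^'n \<Rightarrow> real^'n \<Rightarrow> real"
  assumes g: "pseudo_riemannian g" and br: "bilinear br"
  shows "bilinear (levi_civita br g)"
proof -
  let ?N = "levi_civita br g"
  have bl: "bilinear g"
    using g by (simp add: pseudo_riemannian_def)
  note K = levi_civita_koszul[OF g br]
  have eqI: "x = y" if "\<And>w. 2 * g x w = 2 * g y w" for x y
    using that by (auto intro!: pseudo_riemannian_eqI[OF g])
  note bs = bilinear_ladd[OF bl] bilinear_lmul[OF bl] bilinear_radd[OF bl] bilinear_rmul[OF bl]
    bilinear_ladd[OF br] bilinear_lmul[OF br] bilinear_radd[OF br] bilinear_rmul[OF br]
  have 1: "?N (u + u') v = ?N u v + ?N u' v" for u u' v
  proof (rule eqI)
    fix w
    show "2 * g (?N (u + u') v) w = 2 * g (?N u v + ?N u' v) w"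
      using K[of "u + u'" v w] K[of u v w] K[of u' v w] by (simp add: bs)
  qed
  have 2: "?N u (v + v') = ?N u v + ?N u v'" for u v v'
  proof (rule eqI)
    fix w
    show "2 * g (?N u (v + v')) w = 2 * g (?N u v + ?N u v') w"
      using K[of u "v + v'" w] K[of u v w] K[of u v' w] by (simp add: bs)
  qed
  have 3: "?N (c *\<^sub>R u) v = c *\<^sub>R ?N u v" for c u v
  proof (rule eqI)
    fix w
    have "2 * g (?N (c *\<^sub>R u) v) w = c * (2 * g (?N u v) w)"
      using K[of "c *\<^sub>R u" v w] K[of u v w] by (simp add: bs distrib_left)
    then show "2 * g (?N (c *\<^sub>R u) v) w = 2 * g (c *\<^sub>R ?N u v) w"
      by (simp add: bs)
  qed
  have 4: "?N u (c *\<^sub>R v) = c *\<^sub>R ?N u v" for c u v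
  proof (rule eqI)
    fix w
    have "2 * g (?N u (c *\<^sub>R v)) w = c * (2 * g (?N u v) w)"
      using K[of u "c *\<^sub>R v" w] K[of u v w] by (simp add: bs distrib_left)
    then show "2 * g (?N u (c *\<^sub>R v)) w = 2 * g (c *\<^sub>R ?N u v) w"
      by (simp add: bs)
  qed
  show ?thesis
    unfolding bilinear_def by (auto intro!: linearI simp: 1 2 3 4)
qed

lemma bilinear_ricci:
  fixes g :: "real^'n \<Rightarrow> real^'n \<Rightarrow> real"
  assumes g: "pseudo_riemannian g" and br: "bilinear br"
  shows "bilinear (ricci br g)"
proof -
  note N = bilinear_levi_civita[OF g br]
  note bs = bilinear_ladd[OF N] bilinear_lmul[OF N] bilinear_radd[OF N] bilinear_rmul[OF N]
    bilinear_ladd[OF br] bilinear_lmul[OF br] bilinear_radd[OF br] bilinear_rmul[OF br]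
  show ?thesis
    unfolding bilinear_def
    by (auto intro!: linearI
        simp: ricci_def trace_def matrix_def curvature_def bs algebra_simps
          sum.distrib sum_subtractf sum_distrib_left)
qed

lemma ricci_operator_eq:
  assumes "pseudo_riemannian g" "bilinear br"
  shows "g (ricci_operator br g u) v = ricci br g u v"
proof -
  have "linear (ricci br g u)"
    using bilinear_ricci[OF assms] by (simp add: bilinear_def)
  from theI'[OF pseudo_riemannian_riesz[OF assms(1) this]] show ?thesis
    by (simp add: ricci_operator_def)
qed

lemma linear_ricci_operator:
  assumes g: "pseudo_riemannian g" and br: "bilinear br"
  shows "linear (ricci_operator br g)"
proof -
  have bl: "bilinear g"
    using g by (simp add: pseudo_riemannian_def)
  note bs = bilinear_ladd[OF bl] bilinear_lmul[OF bl]
    bilinear_ladd[OF bilinear_ricci[OF g br]] bilinear_lmul[OF bilinear_ricci[OF g br]]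
  show ?thesis
    by (rule linearI; rule pseudo_riemannian_eqI[OF g])
      (simp_all add: bs ricci_operator_eq[OF g br])
qed

end

theory Submission
  imports Defs
begin

text \<open>
  Evaluating the derivation identity on pairs of basis vectors shows that the derivations of
  \<^const>\<open>g43\<close> are cut out by linear equations on the matrix entries, one of which forces the
  \<open>(4,4)\<close> entry to vanish. Hence \<open>Ric = \<eta> Id + D\<close> determines \<open>\<eta>\<close> as \<open>R\<^sub>4\<^sub>4\<close>, and the remaining
  equations for \<open>D = Ric - \<eta> Id\<close> are the stated conditions. The only property of \<open>Ric\<close> that
  enters is its linearity.
\<close>

lemma derivation_g43_iff:
  fixes A :: "real^4^4"
  shows "derivation g43 (\<lambda>u. A *v u) \<longleftrightarrow>
    A$2$1 = 0 \<and> A$3$1 = 0 \<and> A$4$1 = 0 \<and> A$3$2 = 0 \<and> A$4$2 = 0 \<and> A$4$3 = 0 \<and>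
    A$1$3 = 0 \<and> A$1$2 = 0 \<and> A$3$3 = A$2$2 \<and> A$4$4 = 0" (is "?L \<longleftrightarrow> ?R")
proof
  assume ?L
  then have *: "A *v g43 x y = g43 (A *v x) y + g43 x (A *v y)" for x y
    by (simp add: derivation_def)
  \<comment> \<open>The pair (1,3) kills \<open>A$4$1\<close> and \<open>A$4$3\<close>; (1,4) kills
    \<open>A$2$1\<close>, \<open>A$3$1\<close> and, through its first component
    \<open>A$1$1 = A$1$1 + A$4$4\<close>, also \<open>A$4$4\<close>; (2,4) kills
    \<open>A$1$2\<close> and \<open>A$3$2\<close>. Then (3,4) leaves
    \<open>A$1$3 = A$4$2 = 0\<close> and \<open>A$3$3 = A$2$2\<close>.\<close>
  show ?R
    using *[of "axis 1 1" "axis 3 1"] *[of "axis 1 1" "axis 4 1"]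
      *[of "axis 2 1" "axis 4 1"] *[of "axis 3 1" "axis 4 1"]
    by (simp add: vec_eq_iff forall_4 matrix_vector_mult_def sum_4 axis_def)
next
  assume ?R
  then have "A *v g43 x y = g43 (A *v x) y + g43 x (A *v y)" for x y
    by (simp add: vec_eq_iff forall_4 matrix_vector_mult_def sum_4 algebra_simps)
  then show ?L
    by (simp add: derivation_def)
qed

text \<open>Derivations are linear, so each is given by its matrix; this brings the soliton equation
  into the form to which \<open>derivation_g43_iff\<close> applies.\<close>

lemma algebraic_ricci_soliton_iff_matrix:
  "algebraic_ricci_soliton br g \<longleftrightarrow>
    (\<exists>\<eta> A. derivation br (\<lambda>u. A *v u) \<and> ricci_operator br g = (\<lambda>u. \<eta> *\<^sub>R u + A *v u))"
  (is "?L \<longleftrightarrow> ?R")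
proof
  assume ?L
  then obtain \<eta> D where D: "derivation br D" "\<And>u. ricci_operator br g u = \<eta> *\<^sub>R u + D u"
    by (auto simp: algebraic_ricci_soliton_def)
  have "(\<lambda>u. matrix D *v u) = D"
    using D(1) by (auto simp: derivation_def)
  then have "derivation br (\<lambda>u. matrix D *v u) \<and>
      ricci_operator br g = (\<lambda>u. \<eta> *\<^sub>R u + matrix D *v u)"
    using D by (auto simp: fun_eq_iff)
  then show ?R
    by blast
qed (metis algebraic_ricci_soliton_def)

theorem theorem4p3:
  fixes g :: "real^4 \<Rightarrow> real^4 \<Rightarrow> real"
    and Ric :: "real^4 \<Rightarrow> real^4"
    and R :: "real^4^4"
  assumes "pseudo_riemannian g"
    and "Ric = ricci_operator g43 g"
    and "R = matrix Ric"
  shows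
    "let conds =
           (R$2$1 = 0 \<and> R$3$1 = 0 \<and> R$4$1 = 0 \<and>
            R$3$2 = 0 \<and> R$4$2 = 0 \<and> R$4$3 = 0 \<and>
            R$1$3 = 0 \<and> R$1$2 = 0 \<and> R$3$3 = R$2$2);
         \<eta> = R$4$4;
         D = (vector [vector [R$1$1 - R$4$4, 0, 0, R$1$4],
                      vector [0, R$2$2 - R$4$4, R$2$3, R$2$4],
                      vector [0, 0, R$2$2 - R$4$4, R$3$4],
                      vector [0, 0, 0, 0]] :: real^4^4)
     in (algebraic_ricci_soliton g43 g \<longleftrightarrow> conds) \<and>
        (conds \<longrightarrow>
           (\<forall>u. Ric u = \<eta> *\<^sub>R u + D *v u) \<and>
           derivation g43 (\<lambda>u. D *v u))"
proof -
  define D where "D = (vector [vector [R$1$1 - R$4$4, 0, 0, R$1$4],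
                      vector [0, R$2$2 - R$4$4, R$2$3, R$2$4],
                      vector [0, 0, R$2$2 - R$4$4, R$3$4],
                      vector [0, 0, 0, 0]] :: real^4^4)"
  define conds where "conds \<longleftrightarrow>
           (R$2$1 = 0 \<and> R$3$1 = 0 \<and> R$4$1 = 0 \<and>
            R$3$2 = 0 \<and> R$4$2 = 0 \<and> R$4$3 = 0 \<and>
            R$1$3 = 0 \<and> R$1$2 = 0 \<and> R$3$3 = R$2$2)"
  have "bilinear g43"
    using lie_bracket_g43 by (simp add: lie_bracket_def)
  then have "linear Ric"
    using assms by (simp add: linear_ricci_operator)
  then have Ric: "Ric u = R *v u" for u
    using assms(3) by simp
  have D_der: "derivation g43 (\<lambda>u. D *v u)"
    by (simp add: derivation_g43_iff D_def)
  \<comment> \<open>Under \<open>conds\<close>, \<open>D\<close> is \<open>R\<close> minus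
    \<open>R$4$4\<close> times the identity, entry by entry.\<close>
  have D_Ric: "Ric u = R$4$4 *\<^sub>R u + D *v u" if conds for u
    using that unfolding Ric conds_def D_def
    by (simp add: vec_eq_iff forall_4 matrix_vector_mult_def sum_4 algebra_simps)
  have "algebraic_ricci_soliton g43 g \<longleftrightarrow> conds"
  proof
    assume "algebraic_ricci_soliton g43 g"
    then obtain \<eta> A where A: "derivation g43 (\<lambda>u. A *v u)"
      and "Ric = (\<lambda>u. \<eta> *\<^sub>R u + A *v u)"
      unfolding algebraic_ricci_soliton_iff_matrix assms(2) by blast
    \<comment> \<open>The shift by \<eta> changes only the diagonal, and by the same amount
      everywhere, so the off-diagonal zeros and the equality of the second and third diagonal
      entries pass from \<open>A\<close> to \<open>R\<close>.\<close>
    then have "R $ i $ j = (if i = j then \<eta> else 0) + A $ i $ j" for i j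
      by (simp add: assms(3) matrix_def axis_def matrix_vector_mul_component
          inner_vec_def if_distrib cong: if_cong)
    then show conds
      using A by (simp add: derivation_g43_iff conds_def)
  next
    assume conds
    then show "algebraic_ricci_soliton g43 g"
      using D_der D_Ric unfolding algebraic_ricci_soliton_def assms(2) by blast
  qed
  with D_der D_Ric show ?thesis
    unfolding Let_def D_def conds_def by blast
qed

end
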